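(* The monoid $R_n^0$ has exactly $2^n$ isomorphism classes of simple left (and of simple right) modules over $\mathbb{C}$, all one-dimensional, indexed by the subsets $S\subseteq\{0,1,\dots,n-1\}$. The simple module $S_S$ is spanned by a vector $\varepsilon_S$ on which the generators act by $\pi_i\cdot\varepsilon_S=\varepsilon_S$ if $i\in S$ and $\pi_i\cdot\varepsilon_S=0$ otherwise.
   Context: $R_n^0$ is the monoid presented by generators $\pi_0,\dots,\pi_{n-1}$ and relations $\pi_i^2=\pi_i$ ($0\le i\le n-1$), $\pi_i\pi_{i+1}\pi_i=\pi_{i+1}\pi_i\pi_{i+1}$ ($1\le i\le n-2$), $\pi_1\pi_0\pi_1\pi_0=\pi_0\pi_1\pi_0=\pi_0\pi_1\pi_0\pi_1$, $\pi_i\pi_j=\pi_j\pi_i$ ($0\le i,j\le n-1$, $|i-j|\ge2$). Modules are modules over the monoid algebra $\mathbb{C}[R_n^0]$. *)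

theory Defs
  imports
    Complex_Main
    "HOL-Algebra.Module"
    "HOL-Library.Poly_Mapping"
    "Jordan_Normal_Form.VS_Connect"
begin

section \<open>Presented monoids\<close>

text \<open>
  The monoid presented by a set \<open>X\<close> of generators and a set \<open>R\<close> of relations between words:
  the free monoid \<open>lists X\<close> modulo the smallest congruence containing \<open>R\<close>.
\<close>

inductive_set word_cong :: "'a set \<Rightarrow> ('a list \<times> 'a list) set \<Rightarrow> ('a list \<times> 'a list) set"
  for X :: "'a set" and R :: "('a list \<times> 'a list) set" where
  base: "(u, v) \<in> R \<Longrightarrow> u \<in> lists X \<Longrightarrow> v \<in> lists X \<Longrightarrow> (u, v) \<in> word_cong X R"
| refl: "u \<in> lists X \<Longrightarrow> (u, u) \<in> word_cong X R"
| sym: "(u, v) \<in> word_cong X R \<Longrightarrow> (v, u) \<in> word_cong X R"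
| trans: "(u, v) \<in> word_cong X R \<Longrightarrow> (v, w) \<in> word_cong X R \<Longrightarrow> (u, w) \<in> word_cong X R"
| append: "(u, v) \<in> word_cong X R \<Longrightarrow> (u', v') \<in> word_cong X R
    \<Longrightarrow> (u @ u', v @ v') \<in> word_cong X R"

definition presented_monoid :: "'a set \<Rightarrow> ('a list \<times> 'a list) set \<Rightarrow> 'a list set monoid" where
  "presented_monoid X R =
    \<lparr>carrier = lists X // word_cong X R,
     monoid.mult = (\<lambda>x y. \<Union>u\<in>x. \<Union>v\<in>y. word_cong X R `` {u @ v}),
     one = word_cong X R `` {[]}\<rparr>"

text \<open>
  The monoid \<open>R\<^sub>n\<^sup>0\<close>; the letter \<open>i\<close> stands for the generator \<open>\<pi>\<^sub>i\<close>. The two relations between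
  \<open>\<pi>\<^sub>0\<close> and \<open>\<pi>\<^sub>1\<close> only make sense when \<open>\<pi>\<^sub>1\<close> exists.
\<close>

definition R0_relations :: "nat \<Rightarrow> (nat list \<times> nat list) set" where
  "R0_relations n =
     {([i, i], [i]) | i. i < n} \<union>
     {([i, i + 1, i], [i + 1, i, i + 1]) | i. 1 \<le> i \<and> i + 2 \<le> n} \<union>
     (if 2 \<le> n then {([1, 0, 1, 0], [0, 1, 0]), ([0, 1, 0], [0, 1, 0, 1])} else {}) \<union>
     {([i, j], [j, i]) | i j. i < n \<and> j < n \<and> 2 \<le> \<bar>int i - int j\<bar>}"

definition R0 :: "nat \<Rightarrow> nat list set monoid" where
  "R0 n = presented_monoid {..<n} (R0_relations n)"

definition R0_gen :: "nat \<Rightarrow> nat \<Rightarrow> nat list set" where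
  "R0_gen n i = word_cong {..<n} (R0_relations n) `` {[i]}"


section \<open>Monoid algebras\<close>

text \<open>
  Finitely supported functions on the carrier of \<open>M\<close> under convolution. The library's own
  multiplication on \<open>\<Rightarrow>\<^sub>0\<close> is not used: it takes the monoid structure from the index type.
\<close>

definition monoid_algebra :: "('m, 'b) monoid_scheme \<Rightarrow> ('m \<Rightarrow>\<^sub>0 'k::comm_ring_1) ring" where
  "monoid_algebra M =
    \<lparr>carrier = {f. Poly_Mapping.keys f \<subseteq> carrier M},
     monoid.mult = (\<lambda>f g. \<Sum>x\<in>Poly_Mapping.keys f. \<Sum>y\<in>Poly_Mapping.keys g.
        Poly_Mapping.single (x \<otimes>\<^bsub>M\<^esub> y) (Poly_Mapping.lookup f x * Poly_Mapping.lookup g y)),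
     one = Poly_Mapping.single \<one>\<^bsub>M\<^esub> 1,
     ring.zero = 0,
     add = (+)\<rparr>"

abbreviation R0_algebra :: "nat \<Rightarrow> (nat list set \<Rightarrow>\<^sub>0 complex) ring" where
  "R0_algebra n \<equiv> monoid_algebra (R0 n)"

abbreviation R0_alg_gen :: "nat \<Rightarrow> nat \<Rightarrow> nat list set \<Rightarrow>\<^sub>0 complex" where
  "R0_alg_gen n i \<equiv> Poly_Mapping.single (R0_gen n i) 1"


section \<open>Left and right modules over a noncommutative ring\<close>

text \<open>
  The library's \<^locale>\<open>Module.module\<close> requires a commutative ring of scalars, so only its record type
  is used here; the ring multiplication and unit of that record play no role.
\<close>

locale left_module = R?: ring R + M?: abelian_group M
  for R :: "('r, 'a) ring_scheme" (structure) and M :: "('r, 'v, 'z) module_scheme" (structure) +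
  assumes smult_closed:
      "\<lbrakk>a \<in> carrier R; x \<in> carrier M\<rbrakk> \<Longrightarrow> a \<odot>\<^bsub>M\<^esub> x \<in> carrier M"
    and smult_l_distr:
      "\<lbrakk>a \<in> carrier R; b \<in> carrier R; x \<in> carrier M\<rbrakk>
       \<Longrightarrow> (a \<oplus>\<^bsub>R\<^esub> b) \<odot>\<^bsub>M\<^esub> x = a \<odot>\<^bsub>M\<^esub> x \<oplus>\<^bsub>M\<^esub> b \<odot>\<^bsub>M\<^esub> x"
    and smult_r_distr:
      "\<lbrakk>a \<in> carrier R; x \<in> carrier M; y \<in> carrier M\<rbrakk>
       \<Longrightarrow> a \<odot>\<^bsub>M\<^esub> (x \<oplus>\<^bsub>M\<^esub> y) = a \<odot>\<^bsub>M\<^esub> x \<oplus>\<^bsub>M\<^esub> a \<odot>\<^bsub>M\<^esub> y"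
    and smult_assoc:
      "\<lbrakk>a \<in> carrier R; b \<in> carrier R; x \<in> carrier M\<rbrakk>
       \<Longrightarrow> (a \<otimes>\<^bsub>R\<^esub> b) \<odot>\<^bsub>M\<^esub> x = a \<odot>\<^bsub>M\<^esub> (b \<odot>\<^bsub>M\<^esub> x)"
    and smult_one:
      "x \<in> carrier M \<Longrightarrow> \<one>\<^bsub>R\<^esub> \<odot>\<^bsub>M\<^esub> x = x"

text \<open>For a right module, \<open>a \<odot> x\<close> denotes the right action \<open>x \<cdot> a\<close>.\<close>

locale right_module = R?: ring R + M?: abelian_group M
  for R :: "('r, 'a) ring_scheme" (structure) and M :: "('r, 'v, 'z) module_scheme" (structure) +
  assumes smult_closed:
      "\<lbrakk>a \<in> carrier R; x \<in> carrier M\<rbrakk> \<Longrightarrow> a \<odot>\<^bsub>M\<^esub> x \<in> carrier M"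
    and smult_l_distr:
      "\<lbrakk>a \<in> carrier R; b \<in> carrier R; x \<in> carrier M\<rbrakk>
       \<Longrightarrow> (a \<oplus>\<^bsub>R\<^esub> b) \<odot>\<^bsub>M\<^esub> x = a \<odot>\<^bsub>M\<^esub> x \<oplus>\<^bsub>M\<^esub> b \<odot>\<^bsub>M\<^esub> x"
    and smult_r_distr:
      "\<lbrakk>a \<in> carrier R; x \<in> carrier M; y \<in> carrier M\<rbrakk>
       \<Longrightarrow> a \<odot>\<^bsub>M\<^esub> (x \<oplus>\<^bsub>M\<^esub> y) = a \<odot>\<^bsub>M\<^esub> x \<oplus>\<^bsub>M\<^esub> a \<odot>\<^bsub>M\<^esub> y"
    and smult_assoc:
      "\<lbrakk>a \<in> carrier R; b \<in> carrier R; x \<in> carrier M\<rbrakk>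
       \<Longrightarrow> (a \<otimes>\<^bsub>R\<^esub> b) \<odot>\<^bsub>M\<^esub> x = b \<odot>\<^bsub>M\<^esub> (a \<odot>\<^bsub>M\<^esub> x)"
    and smult_one:
      "x \<in> carrier M \<Longrightarrow> \<one>\<^bsub>R\<^esub> \<odot>\<^bsub>M\<^esub> x = x"

text \<open>
  \<^locale>\<open>Module.submodule\<close> asks for an additive subgroup closed under the action, so it serves for
  both sides.
\<close>

definition simple_left_module :: "('r, 'a) ring_scheme \<Rightarrow> ('r, 'v) module \<Rightarrow> bool" where
  "simple_left_module R M \<longleftrightarrow> left_module R M \<and> carrier M \<noteq> {\<zero>\<^bsub>M\<^esub>} \<and>
     (\<forall>N. Module.submodule N R M \<longrightarrow> N = {\<zero>\<^bsub>M\<^esub>} \<or> N = carrier M)"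

definition simple_right_module :: "('r, 'a) ring_scheme \<Rightarrow> ('r, 'v) module \<Rightarrow> bool" where
  "simple_right_module R M \<longleftrightarrow> right_module R M \<and> carrier M \<noteq> {\<zero>\<^bsub>M\<^esub>} \<and>
     (\<forall>N. Module.submodule N R M \<longrightarrow> N = {\<zero>\<^bsub>M\<^esub>} \<or> N = carrier M)"

definition module_isomorphic ::
    "('r, 'a) ring_scheme \<Rightarrow> ('r, 'v) module \<Rightarrow> ('r, 'w) module \<Rightarrow> bool" where
  "module_isomorphic R M N \<longleftrightarrow> (\<exists>h. bij_betw h (carrier M) (carrier N) \<and>
     (\<forall>x\<in>carrier M. \<forall>y\<in>carrier M. h (x \<oplus>\<^bsub>M\<^esub> y) = h x \<oplus>\<^bsub>N\<^esub> h y) \<and>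
     (\<forall>a\<in>carrier R. \<forall>x\<in>carrier M. h (a \<odot>\<^bsub>M\<^esub> x) = a \<odot>\<^bsub>N\<^esub> h x))"

definition iso_classes ::
    "('r, 'a) ring_scheme \<Rightarrow> ('r, 'v) module set \<Rightarrow> ('r, 'v) module set set" where
  "iso_classes R \<M> = \<M> // {(M, N). M \<in> \<M> \<and> N \<in> \<M> \<and> module_isomorphic R M N}"

text \<open>
  The vector space underlying a module over the monoid algebra: scalars act through multiples of
  the identity element.
\<close>

definition underlying_space ::
    "('m, 'b) monoid_scheme \<Rightarrow> ('m \<Rightarrow>\<^sub>0 'k::comm_ring_1, 'v) module \<Rightarrow> ('k, 'v) module" where
  "underlying_space M V =
    \<lparr>carrier = carrier V, monoid.mult = monoid.mult V, one = one V,
     ring.zero = ring.zero V, add = add V,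
     smult = (\<lambda>c v. Poly_Mapping.single \<one>\<^bsub>M\<^esub> c \<odot>\<^bsub>V\<^esub> v)\<rparr>"

text \<open>
  \<open>fin_dim\<close> is required separately because the library's \<open>dim\<close> is a least cardinality that is
  left unspecified when no finite generating set exists.
\<close>

definition one_dimensional ::
    "('m, 'b) monoid_scheme \<Rightarrow> ('m \<Rightarrow>\<^sub>0 'k::field, 'v) module \<Rightarrow> bool" where
  "one_dimensional M V \<longleftrightarrow>
     vectorspace class_ring (underlying_space M V) \<and>
     vectorspace.fin_dim class_ring (underlying_space M V) \<and>
     vectorspace.dim class_ring (underlying_space M V) = 1"

abbreviation module_span ::
    "('m, 'b) monoid_scheme \<Rightarrow> ('m \<Rightarrow>\<^sub>0 'k::field, 'v) module \<Rightarrow> 'v set \<Rightarrow> 'v set" where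
  "module_span M V B \<equiv> LinearCombinations.module.span class_ring (underlying_space M V) B"


section \<open>The one-dimensional modules indexed by sets of generators\<close>

text \<open>
  The complex line on which an element \<open>x\<close> of \<open>R\<^sub>n\<^sup>0\<close>, which is a class of words, acts by 1 if all
  letters of its words lie in \<open>S\<close> and by 0 otherwise, extended linearly to the monoid algebra.
  The same record is read as a left and as a right module.
\<close>

definition simple_line :: "nat set \<Rightarrow> (nat list set \<Rightarrow>\<^sub>0 complex, complex) module" where
  "simple_line S =
    \<lparr>carrier = UNIV, monoid.mult = (*), one = 1, ring.zero = 0, add = (+),
     smult = (\<lambda>a z. (\<Sum>x\<in>Poly_Mapping.keys a.
        Poly_Mapping.lookup a x * of_bool (\<forall>w\<in>x. set w \<subseteq> S)) * z)\<rparr>"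

end

(*
  Neither finiteness nor any normal form of the monoid is needed. In a nonzero module the generators
  pi_0, ..., pi_{n-1} have a common eigenvector with eigenvalues in {0, 1}: if v is one for
  pi_0, ..., pi_{k-1}, then the last nonzero vector of the chain
  v, pi_k v, pi_{k-1} pi_k v, ..., d = pi_0 ... pi_k v, pi_1 d, pi_2 pi_1 d, ..., pi_k ... pi_1 d
  is one for pi_0, ..., pi_k, except that d itself serves when it is nonzero and pi_0 v = v.
  The line through such a vector is a submodule, hence everything if the module is simple.
  Conversely, both sides of every defining relation involve the same letters, so each set S of
  letters defines a character. Left and right modules are treated at once because the relations
  are invariant under reversal of words.
*)
theory Submission
  imports Defs
begin

section \<open>The presented monoid and its algebra\<close>

lemma word_cong_in_lists: "(u, v) \<in> word_cong X R \<Longrightarrow> u \<in> lists X \<and> v \<in> lists X"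
  by (induction rule: word_cong.induct) auto

lemma equiv_word_cong: "equiv (lists X) (word_cong X R)"
  by (intro equivI subsetI refl_onI symI transI)
    (auto dest: word_cong_in_lists intro: word_cong.intros)

lemma word_class_eq_iff:
  assumes "u \<in> lists X" "v \<in> lists X"
  shows "word_cong X R `` {u} = word_cong X R `` {v} \<longleftrightarrow> (u, v) \<in> word_cong X R"
  using eq_equiv_class_iff[OF equiv_word_cong] assms by metis

lemma carrier_presented_monoid:
  "carrier (presented_monoid X R) = (\<lambda>u. word_cong X R `` {u}) ` lists X"
  by (auto simp: presented_monoid_def quotient_def)

text \<open>Concatenation respects the congruence by the rule \<open>append\<close>, so the union
  over all representatives is a union of copies of one class.\<close>

lemma mult_presented_monoid:
  assumes "u \<in> lists X" "v \<in> lists X"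
  shows "word_cong X R `` {u} \<otimes>\<^bsub>presented_monoid X R\<^esub> word_cong X R `` {v} = word_cong X R `` {u @ v}"
proof -
  have "(\<lambda>u v. word_cong X R `` {u @ v}) respects2 word_cong X R"
    by (rule congruent2I')
      (meson equiv_class_eq[OF equiv_word_cong] word_cong.append)
  then show ?thesis
    using UN_equiv_class2[OF equiv_word_cong equiv_word_cong] assms
    by (simp add: presented_monoid_def)
qed

lemma monoid_presented_monoid: "Group.monoid (presented_monoid X R)"
proof (rule monoidI)
  let ?M = "presented_monoid X R"
  have one: "\<one>\<^bsub>?M\<^esub> = word_cong X R `` {[]}"
    by (simp add: presented_monoid_def)
  have class_in: "word_cong X R `` {u} \<in> carrier ?M" if "u \<in> lists X" for u
    using that by (simp add: carrier_presented_monoid)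
  have append_in: "u @ v \<in> lists X" if "u \<in> lists X" "v \<in> lists X" for u v
    using that by simp
  show "\<one>\<^bsub>?M\<^esub> \<in> carrier ?M"
    by (simp only: one class_in lists.Nil)
  fix x y z
  assume "x \<in> carrier ?M"
  then obtain u where u: "u \<in> lists X" "x = word_cong X R `` {u}"
    by (auto simp only: carrier_presented_monoid)
  show "\<one>\<^bsub>?M\<^esub> \<otimes>\<^bsub>?M\<^esub> x = x" "x \<otimes>\<^bsub>?M\<^esub> \<one>\<^bsub>?M\<^esub> = x"
    by (simp_all only: one u mult_presented_monoid lists.Nil append_Nil append_Nil2)
  assume "y \<in> carrier ?M"
  then obtain v where v: "v \<in> lists X" "y = word_cong X R `` {v}"
    by (auto simp only: carrier_presented_monoid)
  show "x \<otimes>\<^bsub>?M\<^esub> y \<in> carrier ?M"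
    by (simp only: u v mult_presented_monoid class_in append_in)
  assume "z \<in> carrier ?M"
  then obtain w where w: "w \<in> lists X" "z = word_cong X R `` {w}"
    by (auto simp only: carrier_presented_monoid)
  show "x \<otimes>\<^bsub>?M\<^esub> y \<otimes>\<^bsub>?M\<^esub> z = x \<otimes>\<^bsub>?M\<^esub> (y \<otimes>\<^bsub>?M\<^esub> z)"
    by (simp only: u v w mult_presented_monoid append_in append_assoc)
qed

section \<open>The monoid algebra under convolution\<close>

lemma poly_mapping_keys_induct [consumes 1, case_names zero single add]:
  assumes "Poly_Mapping.keys f \<subseteq> A"
    and "P 0"
    and "\<And>x c. x \<in> A \<Longrightarrow> P (Poly_Mapping.single x c)"
    and "\<And>f g. Poly_Mapping.keys f \<subseteq> A \<Longrightarrow> Poly_Mapping.keys g \<subseteq> A \<Longrightarrow> P f \<Longrightarrow> P g \<Longrightarrow> P (f + g)"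
  shows "P f"
  using assms(1)
proof (induction f rule: update_induct)
  case const
  show ?case by (rule assms(2))
next
  case (update f x c)
  \<comment> \<open>The key \<open>x\<close> lies outside the support of \<open>f\<close>, so
    updating there amounts to adding a single term.\<close>
  have eq: "Poly_Mapping.update x c f = f + Poly_Mapping.single x c"
    using update(1)
    by (intro poly_mapping_eqI) (auto simp: lookup_update lookup_add lookup_single in_keys_iff)
  have "Poly_Mapping.keys f \<subseteq> A" "x \<in> A"
    using update by (auto simp: keys_update)
  then show ?case
    unfolding eq using update.IH assms(3,4) by simp
qed

lemma monoid_algebra_simps [simp]:
  "carrier (monoid_algebra M) = {f. Poly_Mapping.keys f \<subseteq> carrier M}"
  "\<zero>\<^bsub>monoid_algebra M\<^esub> = 0"
  "\<one>\<^bsub>monoid_algebra M\<^esub> = Poly_Mapping.single \<one>\<^bsub>M\<^esub> 1"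
  "f \<oplus>\<^bsub>monoid_algebra M\<^esub> g = f + g"
  by (simp_all add: monoid_algebra_def)

text \<open>Cancellation may make the support of \<open>f + g\<close> smaller than the union of the
  supports. The sums still match, because the summand is additive in the coefficient and vanishes at
  0.\<close>

lemma monoid_algebra_mult_add_left:
  "(f + g) \<otimes>\<^bsub>monoid_algebra M\<^esub> h = f \<otimes>\<^bsub>monoid_algebra M\<^esub> h + g \<otimes>\<^bsub>monoid_algebra M\<^esub> h"
  unfolding monoid_algebra_def monoid.simps
  by (rule setsum_keys_plus_distrib) (simp_all add: distrib_right single_add sum.distrib)

lemma monoid_algebra_mult_add_right:
  "f \<otimes>\<^bsub>monoid_algebra M\<^esub> (g + h) = f \<otimes>\<^bsub>monoid_algebra M\<^esub> g + f \<otimes>\<^bsub>monoid_algebra M\<^esub> h"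
  unfolding monoid_algebra_def monoid.simps sum.distrib[symmetric]
  by (intro sum.cong refl setsum_keys_plus_distrib) (simp_all add: distrib_left single_add)

lemma monoid_algebra_mult_zero_left [simp]: "0 \<otimes>\<^bsub>monoid_algebra M\<^esub> f = 0"
  and monoid_algebra_mult_zero_right [simp]: "f \<otimes>\<^bsub>monoid_algebra M\<^esub> 0 = 0"
  by (simp_all add: monoid_algebra_def)

lemma monoid_algebra_mult_single:
  "Poly_Mapping.single x a \<otimes>\<^bsub>monoid_algebra M\<^esub> Poly_Mapping.single y b =
    Poly_Mapping.single (x \<otimes>\<^bsub>M\<^esub> y) (a * b)"
  by (simp add: monoid_algebra_def)

text \<open>Closure, associativity and the unit laws are additive in each argument, so induction on
  the supports reduces them to single terms, where they are the axioms of the monoid.\<close>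

lemma ring_monoid_algebra:
  assumes "Group.monoid M"
  shows "ring (monoid_algebra M :: ('m \<Rightarrow>\<^sub>0 'k::comm_ring_1) ring)"
proof -
  interpret Group.monoid M by fact
  let ?A = "monoid_algebra M :: ('m \<Rightarrow>\<^sub>0 'k) ring"
  have closed: "f \<otimes>\<^bsub>?A\<^esub> g \<in> carrier ?A" if "f \<in> carrier ?A" "g \<in> carrier ?A" for f g
  proof -
    have "Poly_Mapping.keys f \<subseteq> carrier M" "Poly_Mapping.keys g \<subseteq> carrier M"
      using that by auto
    then have "Poly_Mapping.keys (f \<otimes>\<^bsub>?A\<^esub> g) \<subseteq> carrier M"
    proof (induction f rule: poly_mapping_keys_induct)
      case (single x a)
      from single(2,1) show ?case
      proof (induction g rule: poly_mapping_keys_induct)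
        case (add g h)
        then show ?case
          by (simp add: monoid_algebra_mult_add_right order_trans[OF keys_add])
      qed (auto simp: monoid_algebra_mult_single)
    next
      case (add f h)
      then show ?case
        by (simp add: monoid_algebra_mult_add_left order_trans[OF keys_add])
    qed simp
    then show ?thesis by simp
  qed
  have assoc: "f \<otimes>\<^bsub>?A\<^esub> g \<otimes>\<^bsub>?A\<^esub> h = f \<otimes>\<^bsub>?A\<^esub> (g \<otimes>\<^bsub>?A\<^esub> h)"
    if "f \<in> carrier ?A" "g \<in> carrier ?A" "h \<in> carrier ?A" for f g h
  proof -
    have "Poly_Mapping.keys f \<subseteq> carrier M" "Poly_Mapping.keys g \<subseteq> carrier M"
      "Poly_Mapping.keys h \<subseteq> carrier M"
      using that by auto
    then show ?thesis
    proof (induction f rule: poly_mapping_keys_induct)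
      case (single x a)
      from single(2,1,3) show ?case
      proof (induction g rule: poly_mapping_keys_induct)
        case (single y b)
        from single(3,1,2) show ?case
          by (induction h rule: poly_mapping_keys_induct)
            (simp_all add: monoid_algebra_mult_single m_assoc mult.assoc monoid_algebra_mult_add_right)
      qed (simp_all add: monoid_algebra_mult_add_left monoid_algebra_mult_add_right)
    qed (simp_all add: monoid_algebra_mult_add_left)
  qed
  have one: "\<one>\<^bsub>?A\<^esub> \<otimes>\<^bsub>?A\<^esub> f = f \<and> f \<otimes>\<^bsub>?A\<^esub> \<one>\<^bsub>?A\<^esub> = f" if "f \<in> carrier ?A" for f
  proof -
    have "Poly_Mapping.keys f \<subseteq> carrier M"
      using that by simp
    then show ?thesis
      by (induction f rule: poly_mapping_keys_induct)
        (simp_all add: monoid_algebra_mult_single monoid_algebra_mult_add_left monoid_algebra_mult_add_right)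
  qed
  show "ring ?A"
  proof (intro ringI abelian_groupI monoidI)
    fix f assume "f \<in> carrier ?A"
    then show "\<exists>g\<in>carrier ?A. g \<oplus>\<^bsub>?A\<^esub> f = \<zero>\<^bsub>?A\<^esub>"
      by (intro bexI[of _ "- f"]) simp_all
  next
    fix f g assume "f \<in> carrier ?A" "g \<in> carrier ?A"
    then show "f \<oplus>\<^bsub>?A\<^esub> g \<in> carrier ?A"
      using keys_add[of f g] by auto
  qed (use closed assoc one in \<open>auto simp: ac_simps monoid_algebra_mult_add_left monoid_algebra_mult_add_right\<close>)
qed

section \<open>A common eigenvector of the generators\<close>

text \<open>The defining relations as identities between operators. Eigenvalues 0 and 1 can be
  expressed with the zero vector \<open>z\<close> alone, as \<open>p i x \<in> {z, x}\<close>.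
  Reversing the order of composition exchanges \<open>rel_left\<close> and \<open>rel_right\<close>
  and preserves the other relations, so these assumptions fit left and right actions alike.\<close>

locale R0_action =
  fixes n :: nat and p :: "nat \<Rightarrow> 'v \<Rightarrow> 'v" and V :: "'v set" and z :: 'v
  assumes zero_in: "z \<in> V"
    and closed: "i < n \<Longrightarrow> x \<in> V \<Longrightarrow> p i x \<in> V"
    and zero: "i < n \<Longrightarrow> p i z = z"
    and idem: "i < n \<Longrightarrow> x \<in> V \<Longrightarrow> p i (p i x) = p i x"
    and braid: "1 \<le> i \<Longrightarrow> Suc i < n \<Longrightarrow> x \<in> V \<Longrightarrow>
      p i (p (Suc i) (p i x)) = p (Suc i) (p i (p (Suc i) x))"
    and rel_left: "1 < n \<Longrightarrow> x \<in> V \<Longrightarrow> p 1 (p 0 (p 1 (p 0 x))) = p 0 (p 1 (p 0 x))"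
    and rel_right: "1 < n \<Longrightarrow> x \<in> V \<Longrightarrow> p 0 (p 1 (p 0 (p 1 x))) = p 0 (p 1 (p 0 x))"
    and comm: "j < n \<Longrightarrow> Suc i < j \<Longrightarrow> x \<in> V \<Longrightarrow> p i (p j x) = p j (p i x)"
begin

lemma eigenvector_step:
  assumes k: "k < n" and v: "v \<in> V" "v \<noteq> z" and eig: "\<And>i. i < k \<Longrightarrow> p i v \<in> {z, v}"
  shows "\<exists>u\<in>V. u \<noteq> z \<and> (\<forall>i\<le>k. p i u \<in> {z, u})"
proof -
  \<comment> \<open>\<open>s i\<close> is multiplication by the eigenvalue of \<open>p i\<close> on
    \<open>v\<close>. It commutes with every operator because the operators fix
    \<open>z\<close>.\<close>
  define c where "c i \<longleftrightarrow> p i v = v" for i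
  define s where "s i x = (if c i then x else z)" for i x
  have s_in: "s i x \<in> {z, x}" for i x
    by (simp add: s_def)
  have p_s: "p j (s i x) = s i (p j x)" if "j < n" for i j x
    using zero[OF that] by (simp add: s_def)
  \<comment> \<open>\<open>D j\<close> is \<open>p j (p (j + 1) (... (p k v)))\<close>, so the chain
    starts at \<open>D (Suc k) = v\<close> and runs downwards to \<open>D 0\<close>.\<close>
  define D where "D j = foldr p [j..<Suc k] v" for j
  have D_top: "D (Suc k) = v"
    by (simp add: D_def)
  have D_Suc: "D j = p j (D (Suc j))" if "j \<le> k" for j
    using that by (simp add: D_def upt_conv_Cons del: upt_Suc)
  have D_in: "D j \<in> V" if "j \<le> Suc k" for j
    using that
  proof (induction rule: inc_induct)
    case base
    show ?case using D_top v by simp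
  next
    case (step j)
    then show ?case using D_Suc[of j] closed[of j] k by simp
  qed
  \<comment> \<open>Such a \<open>p i\<close> commutes with every factor of \<open>D j\<close> and
    so reaches \<open>v\<close> with its old eigenvalue.\<close>
  have D_low: "p i (D j) = s i (D j)" if "j \<le> Suc k" "Suc i < j" for i j
    using that
  proof (induction rule: inc_induct)
    case base
    then show ?case using eig[of i] D_top by (auto simp: s_def c_def)
  next
    case (step j)
    then have "p i (D j) = p j (p i (D (Suc j)))"
      using D_Suc[of j] comm[of j i "D (Suc j)"] D_in[of "Suc j"] k by simp
    then show ?case
      using step p_s[of j i] D_Suc[of j] k by simp
  qed
  have D_idem: "p j (D j) = D j" if "j \<le> k" for j
    using that D_Suc[of j] idem[of j "D (Suc j)"] D_in[of "Suc j"] k by simp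
  \<comment> \<open>The index shifts by one: after commuting past the smaller letters, the braid
    relation trades \<open>p (Suc i)\<close> on the outside for \<open>p i\<close> on the inside.
    Braiding starts at index 1, so this says nothing about \<open>p 1\<close> on
    \<open>D 0\<close>.\<close>
  have D_high: "p (Suc i) (D j) = s i (D j)" if "j \<le> i" "1 \<le> i" "Suc i \<le> k" for i j
    using that
  proof (induction rule: inc_induct)
    case base
    define y where "y = D (Suc (Suc i))"
    have y: "y \<in> V" "p i y = s i y"
      using base D_in D_low by (auto simp: y_def)
    have D: "D i = p i (p (Suc i) y)"
      using base D_Suc[of i] D_Suc[of "Suc i"] by (simp add: y_def)
    have "p (Suc i) (D i) = p i (p (Suc i) (p i y))"
      using base braid[of i y] y k D by simp
    also have "\<dots> = s i (D i)"
      using y D p_s base k by simp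
    finally show ?case .
  next
    case (step j)
    then have "p (Suc i) (D j) = p j (p (Suc i) (D (Suc j)))"
      using D_Suc[of j] comm[of "Suc i" j "D (Suc j)"] D_in[of "Suc j"] k by simp
    then show ?case
      using step p_s[of j i] D_Suc[of j] k by simp
  qed
  show ?thesis
  proof (cases "D 0 = z")
    case True
    \<comment> \<open>\<open>D (Suc j)\<close> is the last nonzero vector on the way down to
      \<open>D 0\<close>. Letters below \<open>j\<close> keep their eigenvalue, \<open>p j\<close>
      kills it by the choice of \<open>j\<close>, \<open>p (Suc j)\<close> fixes it by idempotence,
      and larger letters have the shifted eigenvalue.\<close>
    obtain j where j: "j \<le> k" "D j = z" "D (Suc j) \<noteq> z"
    proof -
      have "\<exists>j<Suc k. (\<forall>i\<le>j. \<not> D i \<noteq> z) \<and> D (Suc j) \<noteq> z"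
        by (rule ex_least_nat_less[of "\<lambda>j. D j \<noteq> z"]) (use True D_top v in auto)
      then show ?thesis
        using that by (force simp: less_Suc_eq_le)
    qed
    have "p i (D (Suc j)) \<in> {z, D (Suc j)}" if "i \<le> k" for i
    proof -
      consider "i < j" | "i = j" | "i = Suc j" | "Suc j < i"
        by linarith
      then show ?thesis
      proof cases
        case 1
        then show ?thesis using D_low[of "Suc j" i] j s_in by simp
      next
        case 2
        then show ?thesis using D_Suc[of j] j by simp
      next
        case 3
        then show ?thesis using D_idem[of "Suc j"] that by simp
      next
        case 4
        then show ?thesis using D_high[of "Suc j" "i - 1"] that s_in by simp
      qed
    qed
    then show ?thesis
      using j D_in[of "Suc j"] by auto
  next
    case False
    show ?thesis
    \<comment> \<open>Now \<open>D 0\<close> is nonzero and an eigenvector for every letter up to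
      \<open>k\<close> except possibly \<open>p 1\<close>, which is in range only for positive
      \<open>k\<close>.\<close>
    proof (cases "k = 0")
      case True
      then show ?thesis
        using False D_in[of 0] D_idem[of 0] by auto
    next
      case k0: False
      define y where "y = D 2"
      have y: "y \<in> V" "p 0 y = s 0 y"
        using k0 D_in[of 2] D_low[of 2 0] by (auto simp: y_def)
      have D0: "D 0 = p 0 (p 1 y)"
        using k0 D_Suc[of 0] D_Suc[of 1] by (simp add: y_def numeral_2_eq_2)
      have D0_high: "p i (D 0) \<in> {z, D 0}" if "2 \<le> i" "i \<le> k" for i
        using D_high[of 0 "i - 1"] that s_in[of "i - 1" "D 0"] by simp
      show ?thesis
      proof (cases "c 0")
        case True
        \<comment> \<open>Hence \<open>D 0 = p 0 (p 1 (p 0 y))\<close>, a vector fixed by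
          \<open>p 1\<close> according to \<open>rel_left\<close>.\<close>
        then have "p 0 y = y"
          using y by (simp add: s_def)
        then have "p 1 (D 0) = D 0"
          using rel_left[of y] y D0 k k0 by simp
        then have "p i (D 0) \<in> {z, D 0}" if "i \<le> k" for i
          using that D0_high[of i] D_idem[of 0] by (cases "i = 0"; cases "i = 1") auto
        then show ?thesis
          using False D_in[of 0] by auto
      next
        case c0: False
        \<comment> \<open>The chain turns upwards: \<open>X j\<close> is
          \<open>p j (... (p 1 (D 0)))\<close>.\<close>
        define X where "X j = fold p [1..<Suc j] (D 0)" for j
        have X_0: "X 0 = D 0" and X_Suc: "X (Suc j) = p (Suc j) (X j)" for j
          by (simp_all add: X_def)
        have X_in: "X j \<in> V" if "j \<le> k" for j
          using that by (induction j) (use k D_in X_0 X_Suc closed in auto)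
        \<comment> \<open>By \<open>rel_right\<close>, \<open>p 0 (p 1 (p 0 (p 1 y)))\<close> equals
          \<open>p 0 (p 1 (p 0 y))\<close>, and here \<open>p 0 y = z\<close>. The factors added
          after \<open>p 1\<close> commute with \<open>p 0\<close>.\<close>
        have X_zero: "p 0 (X j) = z" if "1 \<le> j" "j \<le> k" for j
          using that
        proof (induction j rule: nat_induct_at_least)
          case base
          have "p 0 (X 1) = p 0 (p 1 (p 0 y))"
            using rel_right[of y] y D0 k k0 X_Suc[of 0] X_0 by simp
          then show ?case
            using y c0 k k0 zero by (simp add: s_def)
        next
          case (Suc j)
          then show ?case
            using comm[of "Suc j" 0 "X j"] X_in[of j] X_Suc[of j] k zero[of "Suc j"] by simp
        qed
        \<comment> \<open>Letters at least two above the last factor commute down to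
          \<open>D 0\<close>, where \<open>D_high\<close> gives their eigenvalue.\<close>
        have X_high: "p (Suc i) (X j) = s i (X j)" if "j < i" "Suc i \<le> k" for i j
          using that
        proof (induction j)
          case 0
          then show ?case using D_high[of 0 i] X_0 by simp
        next
          case (Suc j)
          then have "p (Suc i) (X (Suc j)) = p (Suc j) (p (Suc i) (X j))"
            using comm[of "Suc i" "Suc j" "X j"] X_in[of j] X_Suc[of j] k by simp
          then show ?case
            using Suc p_s[of "Suc j" i] X_Suc[of j] k by simp
        qed
        have X_idem: "p j (X j) = X j" if "1 \<le> j" "j \<le> k" for j
          using that X_Suc[of "j - 1"] idem[of j "X (j - 1)"] X_in[of "j - 1"] k by simp
        \<comment> \<open>A second braid move undoes the index shift of \<open>D_high\<close>:
          \<open>p i\<close> on the outside becomes \<open>p (Suc i)\<close> on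
          \<open>X (i - 1)\<close>, whose eigenvalue there is that of \<open>p i\<close> on
          \<open>v\<close>.\<close>
        have X_low: "p i (X j) = s i (X j)" if "Suc i \<le> j" "1 \<le> i" "j \<le> k" for i j
          using that
        proof (induction j rule: nat_induct_at_least)
          case base
          define x where "x = X (i - 1)"
          have x: "x \<in> V" "p (Suc i) x = s i x"
            using base X_in[of "i - 1"] X_high[of "i - 1" i] by (auto simp: x_def)
          have X: "X (Suc i) = p (Suc i) (p i x)"
            using base X_Suc[of i] X_Suc[of "i - 1"] by (simp add: x_def)
          have "p i (X (Suc i)) = p (Suc i) (p i (p (Suc i) x))"
            using base braid[of i x] x k X by simp
          also have "\<dots> = s i (X (Suc i))"
            using x X p_s base k by simp
          finally show ?case .
        next
          case (Suc j)
          then have "p i (X (Suc j)) = p (Suc j) (p i (X j))"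
            using comm[of "Suc j" i "X j"] X_in[of j] X_Suc[of j] k by simp
          then show ?case
            using Suc p_s[of "Suc j" i] X_Suc[of j] k by simp
        qed
        \<comment> \<open>Either the chain reaches \<open>X k\<close> without vanishing and
          \<open>j = k\<close>, or \<open>j\<close> is the index just before the first zero, so that
          \<open>p (Suc j)\<close> kills \<open>X j\<close>.\<close>
        obtain j where j: "j \<le> k" "X j \<noteq> z" "j < k \<Longrightarrow> X (Suc j) = z"
        proof (cases "\<exists>m\<le>k. X m = z")
          case True
          then obtain m where m: "m \<le> k" "X m = z"
            by auto
          obtain j where "j < m" "X j \<noteq> z" "X (Suc j) = z"
            using ex_least_nat_less[of "\<lambda>j. X j = z" m] False X_0 m by force
          then show ?thesis
            using that[of j] m by simp
        next
          case False
          then show ?thesis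
            using that[of k] by auto
        qed
        have "p i (X j) \<in> {z, X j}" if "i \<le> k" for i
        proof -
          consider "j = 0" "i = 0" | "1 \<le> j" "i = 0" | "1 \<le> i" "Suc i \<le> j" | "i = j" "1 \<le> i"
            | "i = Suc j" | "Suc j < i"
            by linarith
          then show ?thesis
          proof cases
            case 1
            then show ?thesis using D_idem[of 0] X_0 by simp
          next
            case 2
            then show ?thesis using X_zero[of j] j by simp
          next
            case 3
            then show ?thesis using X_low[of i j] s_in j by simp
          next
            case 4
            then show ?thesis using X_idem[of j] j by simp
          next
            case 5
            then show ?thesis using X_Suc[of j] j that by simp
          next
            case 6
            then show ?thesis using X_high[of j "i - 1"] s_in that by simp
          qed
        qed
        then show ?thesis
          using j X_in[of j] by auto
      qed
    qed
  qed
qed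

text \<open>Any nonzero vector is a common eigenvector of the empty set of generators;
  \<open>eigenvector_step\<close> adds the generators one at a time.\<close>

lemma common_eigenvector:
  assumes "v \<in> V" "v \<noteq> z"
  obtains u where "u \<in> V" "u \<noteq> z" "\<forall>i<n. p i u \<in> {z, u}"
proof -
  have "k \<le> n \<Longrightarrow> \<exists>u\<in>V. u \<noteq> z \<and> (\<forall>i<k. p i u \<in> {z, u})" for k
  proof (induction k)
    case 0
    then show ?case using assms by auto
  next
    case (Suc k)
    then obtain u where "u \<in> V" "u \<noteq> z" "\<And>i. i < k \<Longrightarrow> p i u \<in> {z, u}"
      by auto
    then show ?case
      using eigenvector_step[of k u] Suc.prems by (simp add: less_Suc_eq_le)
  qed
  then show ?thesis
    using that by blast
qed

end

section \<open>Modules over a monoid algebra\<close>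

text \<open>Left modules for \<open>left = True\<close>, right modules for \<open>left = False\<close>.\<close>

locale sided_module = R?: ring R + M?: abelian_group M
  for R :: "('r, 'a) ring_scheme" (structure) and M :: "('r, 'v, 'z) module_scheme" (structure)
    and left :: bool +
  assumes smult_closed:
      "\<lbrakk>a \<in> carrier R; x \<in> carrier M\<rbrakk> \<Longrightarrow> a \<odot>\<^bsub>M\<^esub> x \<in> carrier M"
    and smult_l_distr:
      "\<lbrakk>a \<in> carrier R; b \<in> carrier R; x \<in> carrier M\<rbrakk>
       \<Longrightarrow> (a \<oplus>\<^bsub>R\<^esub> b) \<odot>\<^bsub>M\<^esub> x = a \<odot>\<^bsub>M\<^esub> x \<oplus>\<^bsub>M\<^esub> b \<odot>\<^bsub>M\<^esub> x"
    and smult_r_distr: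
      "\<lbrakk>a \<in> carrier R; x \<in> carrier M; y \<in> carrier M\<rbrakk>
       \<Longrightarrow> a \<odot>\<^bsub>M\<^esub> (x \<oplus>\<^bsub>M\<^esub> y) = a \<odot>\<^bsub>M\<^esub> x \<oplus>\<^bsub>M\<^esub> a \<odot>\<^bsub>M\<^esub> y"
    and smult_assoc:
      "\<lbrakk>a \<in> carrier R; b \<in> carrier R; x \<in> carrier M\<rbrakk>
       \<Longrightarrow> (a \<otimes>\<^bsub>R\<^esub> b) \<odot>\<^bsub>M\<^esub> x = (if left then a \<odot>\<^bsub>M\<^esub> (b \<odot>\<^bsub>M\<^esub> x) else b \<odot>\<^bsub>M\<^esub> (a \<odot>\<^bsub>M\<^esub> x))"
    and smult_one:
      "x \<in> carrier M \<Longrightarrow> \<one>\<^bsub>R\<^esub> \<odot>\<^bsub>M\<^esub> x = x"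

lemma left_module_iff_sided: "left_module R M \<longleftrightarrow> sided_module R M True"
  by (simp add: left_module_def left_module_axioms_def sided_module_def sided_module_axioms_def)

lemma right_module_iff_sided: "right_module R M \<longleftrightarrow> sided_module R M False"
  by (simp add: right_module_def right_module_axioms_def sided_module_def sided_module_axioms_def)

context sided_module
begin

lemma smult_l_null: "x \<in> carrier M \<Longrightarrow> \<zero>\<^bsub>R\<^esub> \<odot>\<^bsub>M\<^esub> x = \<zero>\<^bsub>M\<^esub>"
  using smult_l_distr[of "\<zero>\<^bsub>R\<^esub>" "\<zero>\<^bsub>R\<^esub>" x] smult_closed[of "\<zero>\<^bsub>R\<^esub>" x] by simp

lemma smult_r_null: "a \<in> carrier R \<Longrightarrow> a \<odot>\<^bsub>M\<^esub> \<zero>\<^bsub>M\<^esub> = \<zero>\<^bsub>M\<^esub>"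
  using smult_r_distr[of a "\<zero>\<^bsub>M\<^esub>" "\<zero>\<^bsub>M\<^esub>"] smult_closed[of a "\<zero>\<^bsub>M\<^esub>"] by simp

lemma smult_minus_one: 
  assumes "x \<in> carrier M"
  shows "(\<ominus>\<^bsub>R\<^esub> \<one>\<^bsub>R\<^esub>) \<odot>\<^bsub>M\<^esub> x = \<ominus>\<^bsub>M\<^esub> x"
proof -
  have "(\<ominus>\<^bsub>R\<^esub> \<one>\<^bsub>R\<^esub>) \<odot>\<^bsub>M\<^esub> x \<oplus>\<^bsub>M\<^esub> x = \<zero>\<^bsub>M\<^esub>"
    using assms smult_l_distr[of "\<ominus>\<^bsub>R\<^esub> \<one>\<^bsub>R\<^esub>" "\<one>\<^bsub>R\<^esub>" x] 
    by (simp add: R.l_neg smult_l_null smult_one)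
  then show ?thesis
    using assms by (simp add: M.minus_equality smult_closed)
qed

text \<open>Additive inverses come from the action of minus one.\<close>

lemma submoduleI:
  assumes "N \<subseteq> carrier M" "N \<noteq> {}"
    and add: "\<And>x y. x \<in> N \<Longrightarrow> y \<in> N \<Longrightarrow> x \<oplus>\<^bsub>M\<^esub> y \<in> N"
    and smult: "\<And>a x. a \<in> carrier R \<Longrightarrow> x \<in> N \<Longrightarrow> a \<odot>\<^bsub>M\<^esub> x \<in> N"
  shows "Module.submodule N R M"
proof -
  have "\<ominus>\<^bsub>M\<^esub> x \<in> N" if "x \<in> N" for x
    using smult[of "\<ominus>\<^bsub>R\<^esub> \<one>\<^bsub>R\<^esub>" x] smult_minus_one[of x] that assms(1) by auto
  then have "subgroup N (add_monoid M)"
    using assms by (intro M.add.subgroupI) (auto simp: a_inv_def)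
  then show ?thesis
    using smult by (intro Module.submodule.intro submodule_axioms.intro)
qed

end

section \<open>Simplicity and isomorphism on either side\<close>

definition simple_module :: "bool \<Rightarrow> ('r, 'a) ring_scheme \<Rightarrow> ('r, 'v) module \<Rightarrow> bool" where
  "simple_module left R M \<longleftrightarrow> sided_module R M left \<and> carrier M \<noteq> {\<zero>\<^bsub>M\<^esub>} \<and>
     (\<forall>N. Module.submodule N R M \<longrightarrow> N = {\<zero>\<^bsub>M\<^esub>} \<or> N = carrier M)"

lemma simple_left_module_iff: "simple_left_module R M \<longleftrightarrow> simple_module True R M"
  and simple_right_module_iff: "simple_right_module R M \<longleftrightarrow> simple_module False R M"
  by (simp_all add: simple_left_module_def simple_right_module_def simple_module_def
      left_module_iff_sided right_module_iff_sided)

lemma module_isomorphic_refl: "module_isomorphic R M M"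
  unfolding module_isomorphic_def by (intro exI[of _ id]) auto

lemma module_isomorphic_trans:
  assumes "module_isomorphic R M N" "module_isomorphic R N P"
  shows "module_isomorphic R M P"
proof -
  obtain f where f: "bij_betw f (carrier M) (carrier N)"
    "\<forall>x\<in>carrier M. \<forall>y\<in>carrier M. f (x \<oplus>\<^bsub>M\<^esub> y) = f x \<oplus>\<^bsub>N\<^esub> f y"
    "\<forall>a\<in>carrier R. \<forall>x\<in>carrier M. f (a \<odot>\<^bsub>M\<^esub> x) = a \<odot>\<^bsub>N\<^esub> f x"
    using assms(1)[unfolded module_isomorphic_def] by (elim exE conjE)
  obtain g where g: "bij_betw g (carrier N) (carrier P)"
    "\<forall>x\<in>carrier N. \<forall>y\<in>carrier N. g (x \<oplus>\<^bsub>N\<^esub> y) = g x \<oplus>\<^bsub>P\<^esub> g y"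
    "\<forall>a\<in>carrier R. \<forall>x\<in>carrier N. g (a \<odot>\<^bsub>N\<^esub> x) = a \<odot>\<^bsub>P\<^esub> g x"
    using assms(2)[unfolded module_isomorphic_def] by (elim exE conjE)
  have f_in: "f x \<in> carrier N" if "x \<in> carrier M" for x
    using f(1) that by (rule bij_betw_apply)
  have "bij_betw (g \<circ> f) (carrier M) (carrier P)"
    using f(1) g(1) by (rule bij_betw_trans)
  moreover have "\<forall>x\<in>carrier M. \<forall>y\<in>carrier M. (g \<circ> f) (x \<oplus>\<^bsub>M\<^esub> y) = (g \<circ> f) x \<oplus>\<^bsub>P\<^esub> (g \<circ> f) y"
    using f(2) g(2) f_in by simp
  moreover have "\<forall>a\<in>carrier R. \<forall>x\<in>carrier M. (g \<circ> f) (a \<odot>\<^bsub>M\<^esub> x) = a \<odot>\<^bsub>P\<^esub> (g \<circ> f) x"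
    using f(3) g(3) f_in by simp
  ultimately show ?thesis
    unfolding module_isomorphic_def by (intro exI conjI)
qed

text \<open>Every element of \<open>N\<close> is the image of one of \<open>M\<close>. As
  \<open>M\<close> is closed under sums and the action, the equations for \<open>h\<close> can be
  inverted there.\<close>

lemma module_isomorphic_sym:
  assumes "sided_module R M left" "module_isomorphic R M N"
  shows "module_isomorphic R N M"
proof -
  interpret sided_module R M left by fact
  obtain h where h: "bij_betw h (carrier M) (carrier N)"
    "\<forall>x\<in>carrier M. \<forall>y\<in>carrier M. h (x \<oplus>\<^bsub>M\<^esub> y) = h x \<oplus>\<^bsub>N\<^esub> h y"
    "\<forall>a\<in>carrier R. \<forall>x\<in>carrier M. h (a \<odot>\<^bsub>M\<^esub> x) = a \<odot>\<^bsub>N\<^esub> h x"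
    using assms(2)[unfolded module_isomorphic_def] by (elim exE conjE)
  let ?g = "inv_into (carrier M) h"
  have inj: "inj_on h (carrier M)" and surj: "\<And>y. y \<in> carrier N \<Longrightarrow> \<exists>x\<in>carrier M. y = h x"
    using h(1) by (auto simp: bij_betw_def)
  show ?thesis
    unfolding module_isomorphic_def
  proof (intro exI[of _ ?g] conjI ballI)
    show "bij_betw ?g (carrier N) (carrier M)"
      using h(1) by (rule bij_betw_inv_into)
  next
    fix x y assume "x \<in> carrier N" "y \<in> carrier N"
    then obtain a b where "a \<in> carrier M" "x = h a" "b \<in> carrier M" "y = h b"
      using surj by blast
    then show "?g (x \<oplus>\<^bsub>N\<^esub> y) = ?g x \<oplus>\<^bsub>M\<^esub> ?g y"
      using h(2)[rule_format, of a b, symmetric] inj by (simp add: inv_into_f_f)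
  next
    fix a y assume "a \<in> carrier R" "y \<in> carrier N"
    moreover from this obtain x where "x \<in> carrier M" "y = h x"
      using surj by blast
    ultimately show "?g (a \<odot>\<^bsub>N\<^esub> y) = a \<odot>\<^bsub>M\<^esub> ?g y"
      using h(3)[rule_format, of a x, symmetric] inj by (simp add: inv_into_f_f smult_closed)
  qed
qed

section \<open>The vector space underlying a module over a monoid algebra\<close>

locale monoid_algebra_module = G?: Group.monoid G + sided_module "monoid_algebra G" V left
  for G :: "('m, 'b) monoid_scheme" and V :: "('m \<Rightarrow>\<^sub>0 'k::field, 'v) module" and left :: bool
begin

definition scale :: "'k \<Rightarrow> 'v \<Rightarrow> 'v" where
  "scale c x = Poly_Mapping.single \<one>\<^bsub>G\<^esub> c \<odot>\<^bsub>V\<^esub> x"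

lemma scale_closed: "x \<in> carrier V \<Longrightarrow> scale c x \<in> carrier V"
  by (simp add: scale_def smult_closed)

lemma scale_one: "x \<in> carrier V \<Longrightarrow> scale 1 x = x"
  using smult_one[of x] by (simp add: scale_def)

lemma scale_zero: "x \<in> carrier V \<Longrightarrow> scale 0 x = \<zero>\<^bsub>V\<^esub>"
  using smult_l_null[of x] by (simp add: scale_def)

lemma scale_null: "scale c \<zero>\<^bsub>V\<^esub> = \<zero>\<^bsub>V\<^esub>"
  by (simp add: scale_def smult_r_null)

lemma scale_add: "x \<in> carrier V \<Longrightarrow> scale (c + d) x = scale c x \<oplus>\<^bsub>V\<^esub> scale d x"
  using smult_l_distr[of "Poly_Mapping.single \<one>\<^bsub>G\<^esub> c" "Poly_Mapping.single \<one>\<^bsub>G\<^esub> d" x]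
  by (simp add: scale_def single_add)

text \<open>Multiples of the identity are central in the algebra, so they can be moved past
  \<open>g\<close> whichever order of factors the side prescribes.\<close>

lemma single_smult_scale:
  assumes "x \<in> carrier V" "g \<in> carrier G"
  shows "Poly_Mapping.single g c \<odot>\<^bsub>V\<^esub> scale d x = scale (c * d) (Poly_Mapping.single g 1 \<odot>\<^bsub>V\<^esub> x)"
proof -
  have "Poly_Mapping.single g c \<odot>\<^bsub>V\<^esub> scale d x = Poly_Mapping.single g (c * d) \<odot>\<^bsub>V\<^esub> x"
    using assms smult_assoc[of "Poly_Mapping.single g c" "Poly_Mapping.single \<one>\<^bsub>G\<^esub> d" x]
      smult_assoc[of "Poly_Mapping.single \<one>\<^bsub>G\<^esub> d" "Poly_Mapping.single g c" x]
    by (cases left) (simp_all add: scale_def monoid_algebra_mult_single mult.commute)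
  also have "\<dots> = scale (c * d) (Poly_Mapping.single g 1 \<odot>\<^bsub>V\<^esub> x)"
    using assms smult_assoc[of "Poly_Mapping.single g 1" "Poly_Mapping.single \<one>\<^bsub>G\<^esub> (c * d)" x]
      smult_assoc[of "Poly_Mapping.single \<one>\<^bsub>G\<^esub> (c * d)" "Poly_Mapping.single g 1" x]
    by (cases left) (simp_all add: scale_def monoid_algebra_mult_single)
  finally show ?thesis .
qed

lemma scale_scale: "x \<in> carrier V \<Longrightarrow> scale c (scale d x) = scale (c * d) x"
  using single_smult_scale[of x "\<one>\<^bsub>G\<^esub>" c d] smult_one[of x] by (simp add: scale_def)

lemma vectorspace_underlying_space: "vectorspace class_ring (underlying_space G V)"
proof -
  have "abelian_group (underlying_space G V)"
    by (rule abelian_groupI) (auto simp: underlying_space_def M.a_ac intro: M.add.l_inv_ex)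
  moreover have "field (class_ring :: 'k ring)"
    by (rule class_field)
  ultimately have "Module.module (class_ring :: 'k ring) (underlying_space G V)"
    by (intro moduleI)
      (auto simp: underlying_space_def scale_def[symmetric] scale_closed scale_add scale_scale
        scale_one field_def domain_def, simp add: scale_def smult_r_distr)
  with \<open>field class_ring\<close> show ?thesis
    by (simp add: vectorspace_def)
qed

lemma span_singleton:
  assumes u: "u \<in> carrier V" and gen: "carrier V \<subseteq> range (\<lambda>c. scale c u)"
  shows "module_span G V {u} = carrier V"
proof -
  interpret U: vectorspace class_ring "underlying_space G V"
    by (rule vectorspace_underlying_space)
  have carrier: "carrier (underlying_space G V) = carrier V"
    by (simp add: underlying_space_def)
  have sub: "LinearCombinations.submodule class_ring (U.span {u}) (underlying_space G V)"
    using u by (intro U.span_is_submodule) (simp add: carrier)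
  have "u \<in> U.span {u}"
    using u U.in_own_span[of "{u}"] by (simp add: carrier)
  then have "scale c u \<in> U.span {u}" for c
    using LinearCombinations.submodule.smult_closed[OF sub, of c u]
    by (simp add: underlying_space_def scale_def)
  moreover have "U.span {u} \<subseteq> carrier V"
    using u U.span_is_subset2[of "{u}"] by (simp add: carrier)
  ultimately show ?thesis
    using gen by blast
qed

lemma one_dimensionalI:
  assumes u: "u \<in> carrier V" "u \<noteq> \<zero>\<^bsub>V\<^esub>" and gen: "carrier V \<subseteq> range (\<lambda>c. scale c u)"
  shows "one_dimensional G V"
proof -
  interpret U: vectorspace class_ring "underlying_space G V"
    by (rule vectorspace_underlying_space)
  have "U.gen_set {u}" "u \<in> carrier (underlying_space G V)" "u \<noteq> \<zero>\<^bsub>underlying_space G V\<^esub>"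
    using span_singleton[OF u(1) gen] u by (simp_all add: underlying_space_def)
  then have "U.dim = 1" "U.fin_dim"
    unfolding U.fin_dim_def by (blast intro: U.dim1I)+
  then show ?thesis
    by (simp add: one_dimensional_def vectorspace_underlying_space)
qed

text \<open>A nonzero difference \<open>c - d\<close> would kill \<open>u\<close>, and multiplying
  by its inverse would give \<open>u\<close> itself as zero.\<close>

lemma scale_inj:
  assumes "u \<in> carrier V" "u \<noteq> \<zero>\<^bsub>V\<^esub>" "scale c u = scale d u"
  shows "c = d"
proof (rule ccontr)
  assume "c \<noteq> d"
  have "scale (c - d) u = \<zero>\<^bsub>V\<^esub>"
    using scale_add[of u "c - d" d] assms by (simp add: scale_closed)
  then have "scale (inverse (c - d) * (c - d)) u = \<zero>\<^bsub>V\<^esub>"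
    using scale_scale[OF assms(1)] scale_null by metis
  then show False
    using \<open>c \<noteq> d\<close> assms by (simp add: scale_one)
qed

end

section \<open>Simple modules\<close>

abbreviation word_class :: "nat \<Rightarrow> nat list \<Rightarrow> nat list set" where
  "word_class n w \<equiv> word_cong {..<n} (R0_relations n) `` {w}"

lemma word_cong_set_eq: "(u, v) \<in> word_cong {..<n} (R0_relations n) \<Longrightarrow> set u = set v"
proof (induction rule: word_cong.induct)
  case (base u v)
  then show ?case
    by (auto simp: R0_relations_def split: if_splits)
qed auto

text \<open>Congruent words have the same letters, so the condition used in
  \<open>simple_line\<close> can be tested on one representative.\<close>

lemma word_class_set_subset_iff:
  assumes "w \<in> lists {..<n}"
  shows "(\<forall>u\<in>word_class n w. set u \<subseteq> S) \<longleftrightarrow> set w \<subseteq> S"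
  using assms word_cong_set_eq by (auto intro: word_cong.refl)

lemma carrier_R0: "carrier (R0 n) = word_class n ` lists {..<n}"
  by (simp add: R0_def carrier_presented_monoid)

lemma one_R0: "\<one>\<^bsub>R0 n\<^esub> = word_class n []"
  by (simp add: R0_def presented_monoid_def)

lemma mult_R0:
  "u \<in> lists {..<n} \<Longrightarrow> v \<in> lists {..<n} \<Longrightarrow>
    word_class n u \<otimes>\<^bsub>R0 n\<^esub> word_class n v = word_class n (u @ v)"
  unfolding R0_def by (rule mult_presented_monoid)

lemma monoid_R0: "Group.monoid (R0 n)"
  unfolding R0_def by (rule monoid_presented_monoid)

lemma R0_relation_word_class:
  assumes "(u, v) \<in> R0_relations n" "u \<in> lists {..<n}" "v \<in> lists {..<n}"
  shows "word_class n u = word_class n v"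
  using assms by (simp add: word_class_eq_iff word_cong.base)

section \<open>Characters of the monoid and the lines they define\<close>

definition line_char :: "nat set \<Rightarrow> (nat list set \<Rightarrow>\<^sub>0 complex) \<Rightarrow> complex" where
  "line_char S a = (\<Sum>x\<in>Poly_Mapping.keys a. Poly_Mapping.lookup a x * of_bool (\<forall>w\<in>x. set w \<subseteq> S))"

lemma simple_line_simps [simp]:
  "carrier (simple_line S) = UNIV"
  "\<zero>\<^bsub>simple_line S\<^esub> = 0"
  "x \<oplus>\<^bsub>simple_line S\<^esub> y = x + y"
  "a \<odot>\<^bsub>simple_line S\<^esub> x = line_char S a * x"
  by (simp_all add: simple_line_def line_char_def)

lemma line_char_zero [simp]: "line_char S 0 = 0"
  by (simp add: line_char_def)

lemma line_char_add: "line_char S (a + b) = line_char S a + line_char S b"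
  unfolding line_char_def by (rule setsum_keys_plus_distrib) (simp_all add: distrib_right)

lemma line_char_single:
  "w \<in> lists {..<n} \<Longrightarrow> line_char S (Poly_Mapping.single (word_class n w) c) = c * of_bool (set w \<subseteq> S)"
  by (simp add: line_char_def word_class_set_subset_iff)

lemma line_char_one: "line_char S \<one>\<^bsub>R0_algebra n\<^esub> = 1"
  using line_char_single[of "[]" n S 1] by (simp add: one_R0)

text \<open>By additivity in both factors only two words have to be compared, and the letters of a
  concatenation lie in \<open>S\<close> exactly when those of both parts do.\<close>

lemma line_char_mult:
  assumes "a \<in> carrier (R0_algebra n)" "b \<in> carrier (R0_algebra n)"
  shows "line_char S (a \<otimes>\<^bsub>R0_algebra n\<^esub> b) = line_char S a * line_char S b"
proof -
  have "Poly_Mapping.keys a \<subseteq> carrier (R0 n)" "Poly_Mapping.keys b \<subseteq> carrier (R0 n)"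
    using assms by auto
  then show ?thesis
  proof (induction a rule: poly_mapping_keys_induct)
    case (single x c)
    from single(2,1) show ?case
    proof (induction b rule: poly_mapping_keys_induct)
      case (single y d)
      then obtain u v where "u \<in> lists {..<n}" "x = word_class n u" "v \<in> lists {..<n}" "y = word_class n v"
        unfolding carrier_R0 by blast
      moreover from this have "u @ v \<in> lists {..<n}"
        by simp
      ultimately show ?case
        by (simp add: monoid_algebra_mult_single mult_R0 line_char_single del: in_lists_conv_set)
    qed (simp_all add: monoid_algebra_mult_add_right line_char_add distrib_left)
  qed (simp_all add: monoid_algebra_mult_add_left line_char_add distrib_right)
qed

text \<open>The values of the multiplicative \<open>line_char S\<close> are complex numbers and
  commute, so one action satisfies the associativity law of either side.\<close>

lemma sided_module_simple_line: "sided_module (R0_algebra n) (simple_line S) left"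
proof (intro sided_module.intro sided_module_axioms.intro)
  show "ring (R0_algebra n)"
    by (rule ring_monoid_algebra[OF monoid_R0])
  show "abelian_group (simple_line S)"
    by (rule abelian_groupI) (auto intro: exI[of _ "- _"])
qed (simp_all only: simple_line_simps line_char_mult line_char_one, auto simp: line_char_add algebra_simps)

lemma line_char_scalar: "line_char S (Poly_Mapping.single (word_class n []) c) = c"
  by (simp add: line_char_single)

lemma simple_module_simple_line: "simple_module left (R0_algebra n) (simple_line S)"
  unfolding simple_module_def
proof (intro conjI allI impI sided_module_simple_line)
  show "carrier (simple_line S) \<noteq> {\<zero>\<^bsub>simple_line S\<^esub>}"
    by (simp add: set_eq_iff) (metis one_neq_zero)
next
  fix N assume N: "Module.submodule N (R0_algebra n) (simple_line S)"
  have zero: "0 \<in> N"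
    using subgroup.one_closed[OF Module.submodule.axioms(1)[OF N]] by simp
  \<comment> \<open>The scalar \<open>w / z\<close>, taken as a multiple of the identity, carries
    \<open>z\<close> to \<open>w\<close>.\<close>
  have "w \<in> N" if "z \<in> N" "z \<noteq> 0" for z w
    using Module.submodule.smult_closed[OF N, of "Poly_Mapping.single (word_class n []) (w / z)" z] that
    by (simp add: line_char_scalar carrier_R0)
  then show "N = {\<zero>\<^bsub>simple_line S\<^esub>} \<or> N = carrier (simple_line S)"
    using zero by auto
qed

section \<open>The generators acting on an arbitrary module\<close>

locale R0_module = monoid_algebra_module "R0 n" V left
  for n :: nat and V :: "(nat list set \<Rightarrow>\<^sub>0 complex, 'v) module" and left :: bool
begin

abbreviation act :: "nat \<Rightarrow> 'v \<Rightarrow> 'v" where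
  "act i x \<equiv> R0_alg_gen n i \<odot>\<^bsub>V\<^esub> x"

lemma word_class_in_carrier: "w \<in> lists {..<n} \<Longrightarrow> word_class n w \<in> carrier (R0 n)"
  by (simp add: carrier_R0)

lemma act_closed: "i < n \<Longrightarrow> x \<in> carrier V \<Longrightarrow> act i x \<in> carrier V"
  using word_class_in_carrier[of "[i]"] by (simp add: R0_gen_def smult_closed)

text \<open>\<open>fold\<close> applies the first letter first. This is the order of a right action,
  whereas a left action starts with the last letter.\<close>

lemma word_smult:
  assumes "w \<in> lists {..<n}" "x \<in> carrier V"
  shows "Poly_Mapping.single (word_class n w) 1 \<odot>\<^bsub>V\<^esub> x = fold act (if left then rev w else w) x"
  using assms
proof (induction w arbitrary: x)
  case Nil
  then show ?case
    using smult_one[of x] by (simp add: one_R0)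
next
  case (Cons i w)
  have i: "[i] \<in> lists {..<n}" and w: "w \<in> lists {..<n}"
    using Cons.hyps by simp_all
  let ?i = "Poly_Mapping.single (word_class n [i]) (1::complex)"
  let ?w = "Poly_Mapping.single (word_class n w) (1::complex)"
  have "Poly_Mapping.single (word_class n (i # w)) 1 = ?i \<otimes>\<^bsub>R0_algebra n\<^esub> ?w"
    using mult_R0[OF i w] by (simp add: monoid_algebra_mult_single)
  moreover have "?i \<in> carrier (R0_algebra n)" "?w \<in> carrier (R0_algebra n)"
    using word_class_in_carrier[OF i] word_class_in_carrier[OF w] by simp_all
  ultimately show ?case
    using smult_assoc[of ?i ?w x] Cons.IH Cons.prems i act_closed[of i x]
    by (simp add: R0_gen_def)
qed

lemma fold_act_relation:
  assumes "(u, v) \<in> R0_relations n" "u \<in> lists {..<n}" "v \<in> lists {..<n}" "x \<in> carrier V"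
  shows "fold act (if left then rev u else u) x = fold act (if left then rev v else v) x"
  unfolding word_smult[OF assms(2,4), symmetric] word_smult[OF assms(3,4), symmetric]
    R0_relation_word_class[OF assms(1-3)] ..

text \<open>Each defining relation is applied to a vector through \<open>fold_act_relation\<close>.
  Switching sides reverses the words: the two mixed relations between 0 and 1 change places, so both
  are supplied together.\<close>

sublocale R0_action n act "carrier V" "\<zero>\<^bsub>V\<^esub>"
proof
  fix i assume "i < n"
  then show "act i \<zero>\<^bsub>V\<^esub> = \<zero>\<^bsub>V\<^esub>"
    using word_class_in_carrier[of "[i]"] by (simp add: R0_gen_def smult_r_null)
next
  fix i x assume i: "i < n" and x: "x \<in> carrier V"
  have "([i, i], [i]) \<in> R0_relations n"
    using i by (auto simp: R0_relations_def)
  from fold_act_relation[OF this _ _ x] i show "act i (act i x) = act i x"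
    by (cases left) simp_all
next
  fix i x assume i: "1 \<le> i" "Suc i < n" and x: "x \<in> carrier V"
  have "([i, Suc i, i], [Suc i, i, Suc i]) \<in> R0_relations n"
    using i by (auto simp: R0_relations_def)
  from fold_act_relation[OF this _ _ x] i
  show "act i (act (Suc i) (act i x)) = act (Suc i) (act i (act (Suc i) x))"
    by (cases left) simp_all
next
  fix i j x assume ij: "j < n" "Suc i < j" and x: "x \<in> carrier V"
  have "([i, j], [j, i]) \<in> R0_relations n"
    using ij by (auto simp: R0_relations_def)
  from fold_act_relation[OF this _ _ x] ij show "act i (act j x) = act j (act i x)"
    by (cases left) simp_all
next
  fix x assume n: "1 < n" and x: "x \<in> carrier V"
  have "([1, 0, 1, 0], [0, 1, 0]) \<in> R0_relations n" "([0, 1, 0], [0, 1, 0, 1]) \<in> R0_relations n"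
    using n by (auto simp: R0_relations_def)
  from this[THEN fold_act_relation, OF _ _ x] n
  show "act 1 (act 0 (act 1 (act 0 x))) = act 0 (act 1 (act 0 x))"
    and "act 0 (act 1 (act 0 (act 1 x))) = act 0 (act 1 (act 0 x))"
    by (cases left; simp)+
qed (simp_all add: act_closed)

text \<open>The vector stays \<open>u\<close> until the first letter with eigenvalue 0, and from
  then on it stays zero. The outcome depends only on the letters, so it does not change under
  reversal of the word.\<close>

lemma fold_act_eigenvector:
  assumes "u \<in> carrier V" and eig: "\<And>i. i < n \<Longrightarrow> act i u \<in> {\<zero>\<^bsub>V\<^esub>, u}" and "w \<in> lists {..<n}"
  shows "fold act w u = (if set w \<subseteq> {i. i < n \<and> act i u = u} then u else \<zero>\<^bsub>V\<^esub>)"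
proof -
  have null: "fold act w \<zero>\<^bsub>V\<^esub> = \<zero>\<^bsub>V\<^esub>" if "w \<in> lists {..<n}" for w
    using that by (induction w) (auto simp: zero)
  show ?thesis
    using assms(3)
  proof (induction w)
    case (Cons i w)
    then have "i < n" "w \<in> lists {..<n}"
      by auto
    then show ?case
      using Cons.IH eig[of i] null[of w] by (cases "act i u = u") simp_all
  qed simp
qed

text \<open>Additivity in \<open>a\<close> and centrality of the scalars leave the action of one
  word on \<open>u\<close>, which is 1 or 0 exactly as the character prescribes.\<close>

lemma eigenvector_smult:
  assumes u: "u \<in> carrier V" and eig: "\<And>i. i < n \<Longrightarrow> act i u \<in> {\<zero>\<^bsub>V\<^esub>, u}"
    and a: "a \<in> carrier (R0_algebra n)"
  shows "a \<odot>\<^bsub>V\<^esub> scale c u = scale (line_char {i. i < n \<and> act i u = u} a * c) u"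
proof -
  let ?S = "{i. i < n \<and> act i u = u}"
  have "Poly_Mapping.keys a \<subseteq> carrier (R0 n)"
    using a by simp
  then show ?thesis
  proof (induction a rule: poly_mapping_keys_induct)
    case zero
    show ?case
      using u smult_l_null[of "scale c u"] by (simp add: scale_closed scale_zero)
  next
    case (single x d)
    then obtain w where w: "w \<in> lists {..<n}" "x = word_class n w"
      unfolding carrier_R0 by blast
    have "(if left then rev w else w) \<in> lists {..<n}"
      using w by (simp add: in_lists_conv_set)
    then have "Poly_Mapping.single x 1 \<odot>\<^bsub>V\<^esub> u = (if set w \<subseteq> ?S then u else \<zero>\<^bsub>V\<^esub>)"
      using fold_act_eigenvector[OF u eig, of "if left then rev w else w"] word_smult[OF w(1) u] w
      by simp
    then show ?case
      using single_smult_scale[OF u single, of d c] line_char_single[OF w(1), of ?S d] w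
      by (simp add: scale_null scale_zero u)
  next
    case (add a b)
    then show ?case
      using smult_l_distr[of a b "scale c u"] u
      by (simp add: scale_closed line_char_add distrib_right scale_add)
  qed
qed

end

section \<open>Every simple module is a line\<close>

lemma simple_module_line:
  assumes "simple_module left (R0_algebra n) V"
  obtains S where "S \<subseteq> {..<n}" "module_isomorphic (R0_algebra n) (simple_line S) V"
    "one_dimensional (R0 n) V"
proof -
  have "sided_module (R0_algebra n) V left"
    using assms by (simp add: simple_module_def)
  then interpret R0_module n V left
    by (simp add: R0_module_def monoid_algebra_module_def monoid_R0)
  have "\<zero>\<^bsub>V\<^esub> \<in> carrier V" "carrier V \<noteq> {\<zero>\<^bsub>V\<^esub>}"
    using assms by (simp_all add: simple_module_def)
  then obtain v where "v \<in> carrier V" "v \<noteq> \<zero>\<^bsub>V\<^esub>"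
    by blast
  then obtain u where u: "u \<in> carrier V" "u \<noteq> \<zero>\<^bsub>V\<^esub>" and
    eig: "\<forall>i<n. act i u \<in> {\<zero>\<^bsub>V\<^esub>, u}"
    by (rule common_eigenvector)
  define S where "S = {i. i < n \<and> act i u = u}"
  have smult: "a \<odot>\<^bsub>V\<^esub> scale c u = scale (line_char S a * c) u" if "a \<in> carrier (R0_algebra n)" for a c
    unfolding S_def using u(1) eig[rule_format] that by (rule eigenvector_smult)
  \<comment> \<open>The line through \<open>u\<close> is closed under the action by
    \<open>smult\<close> and contains a nonzero vector, so simplicity makes it the whole module;
    \<open>c \<mapsto> scale c u\<close> is then the isomorphism from
    \<open>simple_line S\<close>.\<close>
  let ?N = "range (\<lambda>c. scale c u)"
  have "Module.submodule ?N (R0_algebra n) V"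
  proof (rule submoduleI)
    fix x y assume "x \<in> ?N" "y \<in> ?N"
    then show "x \<oplus>\<^bsub>V\<^esub> y \<in> ?N"
      using scale_add[OF u(1), symmetric] by auto
  qed (use scale_closed[OF u(1)] smult in auto)
  moreover have "u \<in> ?N"
    using scale_one[OF u(1)] by (metis rangeI)
  ultimately have N: "?N = carrier V"
    using assms u unfolding simple_module_def by blast
  have "module_isomorphic (R0_algebra n) (simple_line S) V"
    unfolding module_isomorphic_def
  proof (intro exI[of _ "\<lambda>c. scale c u"] conjI ballI)
    show "bij_betw (\<lambda>c. scale c u) (carrier (simple_line S)) (carrier V)"
      using N scale_inj[OF u] by (auto simp: bij_betw_def inj_on_def)
  qed (simp_all add: scale_add smult u)
  moreover have "one_dimensional (R0 n) V"
    using u N by (intro one_dimensionalI[of u]) simp_all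
  moreover have "S \<subseteq> {..<n}"
    by (auto simp: S_def)
  ultimately show ?thesis
    using that by blast
qed

section \<open>Distinguishing the lines and counting the classes\<close>

lemma simple_line_gen:
  "i < n \<Longrightarrow> R0_alg_gen n i \<odot>\<^bsub>simple_line S\<^esub> z = (if i \<in> S then z else \<zero>\<^bsub>simple_line S\<^esub>)"
  using line_char_single[of "[i]" n S 1] by (simp add: R0_gen_def)

lemma module_span_simple_line: "module_span (R0 n) (simple_line S) {1} = carrier (simple_line S)"
proof -
  interpret R0_module n "simple_line S" True
    using sided_module_simple_line[of n S True]
    by (simp add: R0_module_def monoid_algebra_module_def monoid_R0)
  show ?thesis
    by (rule span_singleton) (auto simp: scale_def one_R0 line_char_scalar)
qed

text \<open>An isomorphism preserves eigenvalues of generators: if \<open>i \<in> S\<close>, then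
  the generator fixes 1 and hence the nonzero image \<open>h 1\<close>, which would be killed if
  \<open>i\<close> were outside \<open>T\<close>.\<close>

lemma simple_line_iso_subset:
  assumes "S \<subseteq> {..<n}" "module_isomorphic (R0_algebra n) (simple_line S) (simple_line T)"
  shows "S \<subseteq> T"
proof
  fix i assume i: "i \<in> S"
  obtain h where bij: "bij_betw h UNIV UNIV" and add: "\<And>x y. h (x + y) = h x + h y"
    and smult: "\<And>a x. a \<in> carrier (R0_algebra n) \<Longrightarrow> h (a \<odot>\<^bsub>simple_line S\<^esub> x) = a \<odot>\<^bsub>simple_line T\<^esub> h x"
    using assms(2) unfolding module_isomorphic_def by (auto simp del: monoid_algebra_simps)
  have "h 0 = 0"
    using add[of 0 0] by simp
  then have "h 1 \<noteq> 0"
    using bij inj_eq[of h 1 0] by (auto simp: bij_betw_def)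
  have "i < n"
    using i assms(1) by auto
  then have "R0_alg_gen n i \<in> carrier (R0_algebra n)"
    by (auto simp: carrier_R0 R0_gen_def)
  from smult[OF this, of 1] show "i \<in> T"
    using simple_line_gen[OF \<open>i < n\<close>, of S 1] simple_line_gen[OF \<open>i < n\<close>, of T "h 1"] i \<open>h 1 \<noteq> 0\<close>
    by (simp del: simple_line_simps(4) split: if_splits)
qed

lemma simple_line_iso_iff:
  assumes "S \<subseteq> {..<n}" "T \<subseteq> {..<n}"
  shows "module_isomorphic (R0_algebra n) (simple_line S) (simple_line T) \<longleftrightarrow> S = T"
proof
  assume iso: "module_isomorphic (R0_algebra n) (simple_line S) (simple_line T)"
  show "S = T"
    using simple_line_iso_subset[OF assms(1) iso]
      simple_line_iso_subset[OF assms(2) module_isomorphic_sym[OF sided_module_simple_line iso]]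
    by (rule equalityI)
qed (simp add: module_isomorphic_refl)

lemma simple_module_classification:
  assumes V: "simple_module left (R0_algebra n) V"
  shows "one_dimensional (R0 n) V \<and>
    (\<exists>!S. S \<subseteq> {..<n} \<and> module_isomorphic (R0_algebra n) V (simple_line S))"
proof -
  obtain S where S: "S \<subseteq> {..<n}" "module_isomorphic (R0_algebra n) (simple_line S) V"
    and dim: "one_dimensional (R0 n) V"
    using V by (rule simple_module_line)
  have "module_isomorphic (R0_algebra n) V (simple_line S)"
    using sided_module_simple_line S(2) by (rule module_isomorphic_sym)
  \<comment> \<open>Two lines isomorphic to \<open>V\<close> are isomorphic to each other through
    \<open>V\<close>.\<close>
  moreover have "T = S" if "T \<subseteq> {..<n}" "module_isomorphic (R0_algebra n) V (simple_line T)" for T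
    using module_isomorphic_trans[OF S(2) that(2)] S(1) that(1) by (simp add: simple_line_iso_iff)
  ultimately show ?thesis
    using S(1) dim by blast
qed

text \<open>Classes are formed among modules whose elements are complex numbers; each line lives
  there, and by \<open>simple_module_line\<close> every class contains one.\<close>

lemma bij_betw_iso_classes:
  "bij_betw (\<lambda>S. {M. simple_module left (R0_algebra n) M \<and>
                     module_isomorphic (R0_algebra n) (simple_line S) M})
     (Pow {..<n})
     (iso_classes (R0_algebra n) {M :: (nat list set \<Rightarrow>\<^sub>0 complex, complex) module.
        simple_module left (R0_algebra n) M})"
    (is "bij_betw ?c _ (iso_classes _ ?\<M>)")
proof -
  let ?iso = "{(M, N). M \<in> ?\<M> \<and> N \<in> ?\<M> \<and> module_isomorphic (R0_algebra n) M N}"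
  have equiv: "equiv ?\<M> ?iso"
  proof (intro equivI refl_onI symI transI)
    fix M N assume "(M, N) \<in> ?iso"
    then show "(N, M) \<in> ?iso"
      using module_isomorphic_sym[of "R0_algebra n" M left N] by (simp add: simple_module_def)
  next
    fix M N P assume "(M, N) \<in> ?iso" "(N, P) \<in> ?iso"
    then show "(M, P) \<in> ?iso"
      using module_isomorphic_trans[of "R0_algebra n" M N P] by simp
  qed (simp_all add: module_isomorphic_refl split_beta subset_iff)
  have line: "simple_line S \<in> ?\<M>" for S
    by (simp add: simple_module_simple_line)
  \<comment> \<open>As \<open>simple_line S\<close> is itself simple, the set in the statement is
    its full equivalence class, and injectivity becomes a question about isomorphic lines.\<close>
  have c: "?c S = ?iso `` {simple_line S}" for S
    by (simp add: Image_singleton simple_module_simple_line)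
  have iso_iff: "?c S = ?c M \<longleftrightarrow> (simple_line S, simple_line M) \<in> ?iso" for S M
    unfolding c using equiv line line by (rule eq_equiv_class_iff)
  have "inj_on ?c (Pow {..<n})"
  proof (rule inj_onI)
    fix S T assume "S \<in> Pow {..<n}" "T \<in> Pow {..<n}" "?c S = ?c T"
    then show "S = T"
      unfolding iso_iff by (simp add: simple_line_iso_iff)
  qed
  moreover have "?c ` Pow {..<n} = ?\<M> // ?iso"
  proof (intro equalityI subsetI)
    fix C assume "C \<in> ?\<M> // ?iso"
    then obtain M where M: "M \<in> ?\<M>" "C = ?iso `` {M}"
      by (rule quotientE)
    from M(1) obtain S where S: "S \<subseteq> {..<n}" "module_isomorphic (R0_algebra n) (simple_line S) M"
      using simple_module_line[of left n M] by (metis mem_Collect_eq)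
    have "?iso `` {simple_line S} = ?iso `` {M}"
      using equiv by (rule equiv_class_eq) (use S(2) M(1) line in simp)
    then have "C = ?c S"
      by (simp only: c M(2))
    then show "C \<in> ?c ` Pow {..<n}"
      using S(1) by (intro image_eqI[of _ _ S]) simp_all
  next
    fix C assume "C \<in> ?c ` Pow {..<n}"
    then obtain S where "C = ?c S"
      by (rule imageE)
    then show "C \<in> ?\<M> // ?iso"
      unfolding c using line[of S] by (simp only: quotientI)
  qed
  ultimately show ?thesis
    unfolding bij_betw_def iso_classes_def by (rule conjI)
qed

lemma card_iso_classes:
  "card (iso_classes (R0_algebra n) {M :: (nat list set \<Rightarrow>\<^sub>0 complex, complex) module.
      simple_module left (R0_algebra n) M}) = 2 ^ n"
  using bij_betw_same_card[OF bij_betw_iso_classes[of left n]] by (simp add: card_Pow)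

lemma simple_line_spec:
  "simple_module left (R0_algebra n) (simple_line S) \<and>
    (\<exists>\<epsilon> \<in> carrier (simple_line S).
       module_span (R0 n) (simple_line S) {\<epsilon>} = carrier (simple_line S) \<and>
       (\<forall>i<n. R0_alg_gen n i \<odot>\<^bsub>simple_line S\<^esub> \<epsilon> =
          (if i \<in> S then \<epsilon> else \<zero>\<^bsub>simple_line S\<^esub>)))"
  by (intro conjI bexI[of _ 1] allI impI simple_module_simple_line module_span_simple_line
      simple_line_gen) simp_all

theorem theorem5p8:
  fixes n :: nat
  shows
    "(\<forall>S \<subseteq> {..<n}.
        simple_left_module (R0_algebra n) (simple_line S) \<and>
        (\<exists>\<epsilon> \<in> carrier (simple_line S).
           module_span (R0 n) (simple_line S) {\<epsilon>} = carrier (simple_line S) \<and>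
           (\<forall>i<n. R0_alg_gen n i \<odot>\<^bsub>simple_line S\<^esub> \<epsilon> =
              (if i \<in> S then \<epsilon> else \<zero>\<^bsub>simple_line S\<^esub>)))) \<and>
     (\<forall>M :: (nat list set \<Rightarrow>\<^sub>0 complex, 'v) module. simple_left_module (R0_algebra n) M \<longrightarrow>
        one_dimensional (R0 n) M \<and>
        (\<exists>!S. S \<subseteq> {..<n} \<and> module_isomorphic (R0_algebra n) M (simple_line S))) \<and>
     bij_betw (\<lambda>S. {M. simple_left_module (R0_algebra n) M \<and>
                       module_isomorphic (R0_algebra n) (simple_line S) M})
       (Pow {..<n})
       (iso_classes (R0_algebra n)
          {M :: (nat list set \<Rightarrow>\<^sub>0 complex, complex) module. simple_left_module (R0_algebra n) M}) \<and>
     card (iso_classes (R0_algebra n)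
       {M :: (nat list set \<Rightarrow>\<^sub>0 complex, complex) module. simple_left_module (R0_algebra n) M}) = 2 ^ n \<and>
     (\<forall>S \<subseteq> {..<n}.
        simple_right_module (R0_algebra n) (simple_line S) \<and>
        (\<exists>\<epsilon> \<in> carrier (simple_line S).
           module_span (R0 n) (simple_line S) {\<epsilon>} = carrier (simple_line S) \<and>
           (\<forall>i<n. R0_alg_gen n i \<odot>\<^bsub>simple_line S\<^esub> \<epsilon> =
              (if i \<in> S then \<epsilon> else \<zero>\<^bsub>simple_line S\<^esub>)))) \<and>
     (\<forall>M :: (nat list set \<Rightarrow>\<^sub>0 complex, 'v) module. simple_right_module (R0_algebra n) M \<longrightarrow>
        one_dimensional (R0 n) M \<and>
        (\<exists>!S. S \<subseteq> {..<n} \<and> module_isomorphic (R0_algebra n) M (simple_line S))) \<and>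
     bij_betw (\<lambda>S. {M. simple_right_module (R0_algebra n) M \<and>
                       module_isomorphic (R0_algebra n) (simple_line S) M})
       (Pow {..<n})
       (iso_classes (R0_algebra n)
          {M :: (nat list set \<Rightarrow>\<^sub>0 complex, complex) module. simple_right_module (R0_algebra n) M}) \<and>
     card (iso_classes (R0_algebra n)
       {M :: (nat list set \<Rightarrow>\<^sub>0 complex, complex) module. simple_right_module (R0_algebra n) M}) = 2 ^ n"
  \<comment> \<open>The conjuncts are the same four facts about \<open>simple_module left\<close>,
    first for \<open>True\<close> and then for \<open>False\<close>.\<close>
  unfolding simple_left_module_iff simple_right_module_iff
  by (intro conjI; (intro allI impI)?; rule simple_line_spec simple_module_classification
      bij_betw_iso_classes card_iso_classes)

end
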